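(* Let $k\ge 2$, let $0=r_0<r_1<\dots<r_k$ be integers, $d=\gcd(r_1,\dots,r_k)$, $S=\langle r_1,\dots,r_k\rangle$, $N_0=\max\{r_k^2,r_k^2+\operatorname{F}(S)r_k\}$, and let $n>N_0$ be an integer with $\gcd(n,d)=1$. Let $M_n=\langle n,n+r_1,\dots,n+r_k\rangle$. Let $f\in\operatorname{PF}(M_n)$ and $f\equiv i\bmod n$ with $i\in\operatorname{Ap}(S,dn)$. Then, for every $\lambda\in\mathbb{N}$, $$\varphi_n^\lambda(f)=\begin{cases} f+(\mathbf{m}(i)-1)\lambda r_k & \text{if } i<dn-r_k,\\ f+(\mathbf{m}(i)+(\lambda+1)d-1)\lambda r_k+\lambda dn & \text{if } i\ge dn-r_k.\end{cases}$$
   Context: $\mathbb{N}$ includes $0$, and $\langle a_1,\dots,a_s\rangle=\{\sum\lambda_i a_i\mid\lambda_i\in\mathbb{N}\}$. For a numerical semigroup $H$, $\operatorname{PF}(H)=\{x\in\mathbb{Z}\setminus H\mid x+h\in H\ \forall\, 0\neq h\in H\}$. $\operatorname{F}(S)=\max\{s\in\mathbb{Z}\setminus S\mid s\equiv0\bmod d\}$ (possibly negative). $\operatorname{Ap}(S,dn)=\{s\in S\mid s-dn\notin S\}$. For $i\in S$, $\mathbf{m}(i)$ is the minimum of $\lambda_1+\dots+\lambda_k$ over all expressions $i=\lambda_1r_1+\dots+\lambda_kr_k$ with $\lambda_j\in\mathbb{N}$. For $n>N_0$ with $\gcd(n,d)=1$: $P_n=\{i\in\operatorname{Ap}(S,dn)\mid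 f\equiv i\bmod n\text{ for some }f\in\operatorname{PF}(M_n)\}$. Each $f\in\operatorname{PF}(M_n)$ is congruent mod $n$ to a unique $i\in P_n$, and this gives a bijection $\operatorname{PF}(M_n)\to P_n$. The map $\psi_n:P_n\to P_{n+r_k}$, $\psi_n(i)=i$ if $i<dn-r_k$ and $\psi_n(i)=i+dr_k$ if $i\ge dn-r_k$, is a bijection, and $\varphi_n:\operatorname{PF}(M_n)\to\operatorname{PF}(M_{n+r_k})$ is the induced bijection: if $f\equiv i\bmod n$ with $i\in P_n$, then $\varphi_n(f)$ is the unique element of $\operatorname{PF}(M_{n+r_k})$ congruent to $\psi_n(i)$ mod $n+r_k$. Put $\varphi_n^\lambda=\varphi_{n+(\lambda-1)r_k}\circ\dots\circ\varphi_{n+r_k}\circ\varphi_n:\operatorname{PF}(M_n)\to\operatorname{PF}(M_{n+\lambda r_k})$ ($\varphi_n^0=\mathrm{id}$). *)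

theory Defs
  imports Main "HOL-Number_Theory.Cong"
begin

definition gen_semigroup :: "'i set \<Rightarrow> ('i \<Rightarrow> int) \<Rightarrow> int set" where
  "gen_semigroup I a = {\<Sum>j\<in>I. int (l j) * a j | l :: 'i \<Rightarrow> nat. True}"

definition PF :: "int set \<Rightarrow> int set" where
  "PF H = {x. x \<notin> H \<and> (\<forall>h\<in>H. h \<noteq> 0 \<longrightarrow> x + h \<in> H)}"

text \<open>
  The data \<open>k\<close> and \<open>r\<close> describe integers \<open>0 = r 0 < r 1 < \<dots> < r k\<close>; values of \<open>r\<close> beyond
  \<open>k\<close> are irrelevant.
\<close>

definition gcd_r :: "nat \<Rightarrow> (nat \<Rightarrow> int) \<Rightarrow> int" where
  "gcd_r k r = Gcd (r ` {1..k})"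

definition S_semi :: "nat \<Rightarrow> (nat \<Rightarrow> int) \<Rightarrow> int set" where
  "S_semi k r = gen_semigroup {1..k} r"

definition M_semi :: "nat \<Rightarrow> (nat \<Rightarrow> int) \<Rightarrow> int \<Rightarrow> int set" where
  "M_semi k r n = gen_semigroup {0..k} (\<lambda>j. n + r j)"

text \<open>
  The maximum is taken over all integers, so that it equals \<open>- d\<close> if \<open>S\<close> contains every
  nonnegative multiple of its gcd \<open>d\<close>.
\<close>

definition Frob :: "nat \<Rightarrow> (nat \<Rightarrow> int) \<Rightarrow> int" where
  "Frob k r = (GREATEST s. s \<notin> S_semi k r \<and> [s = 0] (mod gcd_r k r))"

definition N0 :: "nat \<Rightarrow> (nat \<Rightarrow> int) \<Rightarrow> int" where
  "N0 k r = max ((r k)\<^sup>2) ((r k)\<^sup>2 + Frob k r * r k)"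

definition Ap :: "int set \<Rightarrow> int \<Rightarrow> int set" where
  "Ap H m = {s \<in> H. s - m \<notin> H}"

definition min_len :: "nat \<Rightarrow> (nat \<Rightarrow> int) \<Rightarrow> int \<Rightarrow> nat" where
  "min_len k r i = (LEAST m. \<exists>l :: nat \<Rightarrow> nat.
     i = (\<Sum>j=1..k. int (l j) * r j) \<and> m = (\<Sum>j=1..k. l j))"

definition P_set :: "nat \<Rightarrow> (nat \<Rightarrow> int) \<Rightarrow> int \<Rightarrow> int set" where
  "P_set k r n =
     {i \<in> Ap (S_semi k r) (gcd_r k r * n). \<exists>f \<in> PF (M_semi k r n). [f = i] (mod n)}"

definition psi :: "nat \<Rightarrow> (nat \<Rightarrow> int) \<Rightarrow> int \<Rightarrow> int \<Rightarrow> int" where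
  "psi k r n i = (if i < gcd_r k r * n - r k then i else i + gcd_r k r * r k)"

text \<open>
  For \<open>n > N0 k r\<close> coprime to \<open>gcd_r k r\<close>, \<open>phi k r n\<close> is the map from \<open>PF (M_semi k r n)\<close> to
  \<open>PF (M_semi k r (n + r k))\<close> induced by \<open>psi k r n\<close>: both descriptions below are then uniquely
  satisfied. It is meaningless on other arguments.
\<close>

definition phi :: "nat \<Rightarrow> (nat \<Rightarrow> int) \<Rightarrow> int \<Rightarrow> int \<Rightarrow> int" where
  "phi k r n f =
     (let i = (THE i. i \<in> P_set k r n \<and> [f = i] (mod n))
      in THE g. g \<in> PF (M_semi k r (n + r k)) \<and> [g = psi k r n i] (mod (n + r k)))"

primrec phi_iter :: "nat \<Rightarrow> (nat \<Rightarrow> int) \<Rightarrow> int \<Rightarrow> nat \<Rightarrow> int \<Rightarrow> int" where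
  "phi_iter k r n 0 f = f"
| "phi_iter k r n (Suc l) f = phi k r (n + int l * r k) (phi_iter k r n l f)"

end

theory Submission
  imports Defs
begin

text \<open>
  Write \<open>R\<close> for \<open>r k\<close>, \<open>m i\<close> for the minimal length of \<open>i\<close>, and \<open>M n\<close> for the semigroup
  generated by \<open>n + r 0, \<dots>, n + r k\<close>. The elements of \<open>M n\<close> are the sums \<open>L n + s\<close> where \<open>s \<in> S\<close>
  can be written with at most \<open>L\<close> generators. One element can have several such descriptions,
  but, as \<open>n\<close> is coprime to \<open>d\<close> and \<open>d\<close> divides every element of \<open>S\<close>, the values of \<open>s\<close> differ by multiples of
  \<open>d n\<close>. For large \<open>n\<close> the smallest \<open>s\<close> is also the shortest, so an Apery element \<open>i\<close> decides
  membership for its whole residue class mod \<open>n\<close>: \<open>b n + i \<in> M n\<close> iff \<open>m i \<le> b\<close>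
  (\<open>Ap_len_least\<close>). Hence the only possible pseudo-Frobenius number congruent to \<open>i\<close> is
  \<open>i + (m i - 1) n\<close>, and it is one iff \<open>i + r j + m i n \<in> M n\<close> for all \<open>j\<close>. This in turn is a
  condition about lengths in \<open>S\<close> alone (\<open>PF_of_in_PF_iff\<close>).

  Two facts about lengths carry the argument. In a shortest expression fewer than \<open>R\<close> terms
  differ from \<open>R\<close>: among any \<open>R\<close> terms some block has a sum divisible by \<open>R\<close>, and replacing
  this block by copies of \<open>R\<close> would shorten the expression. So \<open>m x\<close> is \<open>x / R\<close> up to an error
  less than \<open>R\<close>, which gives \<open>m x < m y\<close> as soon as \<open>y \<ge> x + R\<^sup>2\<close>; and a shortest expression of
  a large number uses \<open>R\<close>, which gives \<open>m (x + R) = m x + 1\<close>.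

  On passing from \<open>n\<close> to \<open>n + R\<close>, an \<open>i < d n - R\<close> stays fixed and its condition mentions no
  difference \<open>i + r j - d n\<close> that lies in \<open>S\<close>, so it does not change. An \<open>i \<ge> d n - R\<close> moves to
  \<open>i + d R\<close>: the lengths of \<open>i\<close> and \<open>i + r j\<close> grow by \<open>d\<close>, and \<open>i + r j - d n\<close> is unchanged, so
  the condition survives. Therefore \<open>phi\<close> sends \<open>i + (m i - 1) n\<close> to the corresponding number
  for \<open>psi i\<close> and \<open>n + R\<close>. The formula is this, iterated, with \<open>m (i + l d R) = m i + l d\<close>.
\<close>

section \<open>Blocks with divisible sum, greatest integers and Bezout coefficients\<close>

text \<open>Among the \<open>N + 1\<close> prefix sums of the first \<open>N\<close> entries two agree modulo \<open>N\<close>.\<close>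
lemma zero_sum_block:
  fixes a :: "'a \<Rightarrow> int" and N :: int
  assumes "0 < N" "N \<le> int (length ys)"
  shows "\<exists>A B C. ys = A @ B @ C \<and> B \<noteq> [] \<and> N dvd sum_list (map a B)"
proof -
  define p where "p t = sum_list (map a (take t ys)) mod N" for t
  have "p ` {..nat N} \<subseteq> {0..<N}"
    using assms(1) by (auto simp: p_def)
  then have "card (p ` {..nat N}) \<le> card {0..<N}"
    by (intro card_mono) auto
  then have "card (p ` {..nat N}) < card {..nat N}"
    by simp
  then have "\<not> inj_on p {..nat N}"
    by (rule pigeonhole)
  then obtain s t where st: "s < t" "t \<le> nat N" "p s = p t"
    by (auto simp: inj_on_def) (metis linorder_neqE_nat)
  define B where "B = drop s (take t ys)"
  have split: "take t ys = take s ys @ B"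
    using st(1) unfolding B_def by (metis append_take_drop_id min.absorb1 order_less_imp_le take_take)
  have "ys = take s ys @ B @ drop t ys"
    by (metis split append.assoc append_take_drop_id)
  moreover have "B \<noteq> []"
    using st assms by (simp add: B_def)
  moreover have "N dvd sum_list (map a B)"
    using st(3) unfolding p_def split by (simp add: mod_eq_dvd_iff dvd_diff_commute)
  ultimately show ?thesis by blast
qed

text \<open>
  The integers are not bounded below, so the greatest element is found as a maximum of the finite
  set that remains above one witness.
\<close>
lemma le_Greatest_int:
  fixes P :: "int \<Rightarrow> bool"
  assumes "P a" and bound: "\<And>y. P y \<Longrightarrow> y \<le> b"
  shows "a \<le> (GREATEST y. P y)"
proof -
  let ?A = "{y. P y \<and> a \<le> y}"
  have "?A \<subseteq> {a..b}" using bound by auto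
  then have fin: "finite ?A" by (rule finite_subset) simp
  have ne: "?A \<noteq> {}" using assms(1) by auto
  have "P (Max ?A)" using Max_in[OF fin ne] by simp
  moreover have le: "y \<le> Max ?A" if "P y" for y
  proof (cases "a \<le> y")
    case True
    then show ?thesis using that fin by (intro Max_ge) auto
  next
    case False
    then show ?thesis using Max_ge[OF fin, of a] assms(1) by auto
  qed
  ultimately have "(GREATEST y. P y) = Max ?A"
    by (rule Greatest_equality)
  then show ?thesis using le[OF assms(1)] by simp
qed

lemma Gcd_image_eq_sum:
  fixes a :: "'i \<Rightarrow> int"
  assumes "finite I"
  shows "\<exists>c. Gcd (a ` I) = (\<Sum>j\<in>I. c j * a j)"
  using assms
proof (induction I)
  case (insert i I)
  then obtain c where c: "Gcd (a ` I) = (\<Sum>j\<in>I. c j * a j)" by blast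
  obtain u v where uv: "u * a i + v * Gcd (a ` I) = gcd (a i) (Gcd (a ` I))"
    using bezout_int by blast
  have "(\<Sum>j\<in>I. ((\<lambda>j. v * c j)(i := u)) j * a j) = (\<Sum>j\<in>I. v * (c j * a j))"
    using insert.hyps by (intro sum.cong) auto
  then have "Gcd (a ` insert i I) = (\<Sum>j\<in>insert i I. ((\<lambda>j. v * c j)(i := u)) j * a j)"
    using insert.hyps uv c by (simp add: sum_distrib_left)
  then show ?case by blast
qed simp

section \<open>Expressions and lengths in the unshifted semigroup\<close>

locale shifted_family =
  fixes k :: nat and r :: "nat \<Rightarrow> int"
  assumes k_pos: "0 < k" and r_0: "r 0 = 0" and r_mono: "strict_mono_on {0..k} r"
begin

abbreviation "R \<equiv> r k"
abbreviation "d \<equiv> gcd_r k r"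
abbreviation "S \<equiv> S_semi k r"
abbreviation "M \<equiv> M_semi k r"
abbreviation "len \<equiv> min_len k r"

definition has_length :: "int \<Rightarrow> nat \<Rightarrow> bool" where
  "has_length x c \<longleftrightarrow> (\<exists>l :: nat \<Rightarrow> nat. x = (\<Sum>j=1..k. int (l j) * r j) \<and> c = (\<Sum>j=1..k. l j))"

lemma r_pos: "j \<in> {1..k} \<Longrightarrow> 0 < r j"
  using strict_mono_onD[OF r_mono, of 0 j] r_0 by auto

lemma r_less: "j \<in> {1..k} \<Longrightarrow> j \<noteq> k \<Longrightarrow> r j < R"
  using strict_mono_onD[OF r_mono, of j k] by auto

lemma r_le: "j \<in> {1..k} \<Longrightarrow> r j \<le> R"
  using r_less by (cases "j = k") force+

lemma R_pos: "0 < R"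
  using r_pos k_pos by auto

lemma d_pos: "0 < d"
proof -
  have "d dvd R" unfolding gcd_r_def using k_pos by (intro Gcd_dvd) auto
  moreover have "0 \<le> d" unfolding gcd_r_def by simp
  ultimately show ?thesis using R_pos by (cases "d = 0") auto
qed

lemma d_dvd_r: "j \<in> {1..k} \<Longrightarrow> d dvd r j"
  unfolding gcd_r_def by (intro Gcd_dvd) auto

lemma d_dvd_R: "d dvd R"
  using d_dvd_r k_pos by auto

lemma has_length_0: "has_length 0 0"
  unfolding has_length_def by (intro exI[of _ "\<lambda>_. 0"]) simp

lemma has_length_add: "has_length x a \<Longrightarrow> has_length y b \<Longrightarrow> has_length (x + y) (a + b)"
  unfolding has_length_def
proof (elim exE conjE)
  fix l l' :: "nat \<Rightarrow> nat"
  assume "x = (\<Sum>j=1..k. int (l j) * r j)" "a = (\<Sum>j=1..k. l j)"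
    "y = (\<Sum>j=1..k. int (l' j) * r j)" "b = (\<Sum>j=1..k. l' j)"
  then show "\<exists>l. x + y = (\<Sum>j=1..k. int (l j) * r j) \<and> a + b = (\<Sum>j=1..k. l j)"
    by (intro exI[of _ "\<lambda>j. l j + l' j"]) (simp add: sum.distrib algebra_simps)
qed

lemma has_length_gen:
  assumes "j \<in> {1..k}"
  shows "has_length (r j) 1"
  unfolding has_length_def
proof (intro exI[of _ "\<lambda>i. of_bool (i = j)"] conjI)
  have "(\<Sum>i=1..k. int (of_bool (i = j)) * r i) = (\<Sum>i=1..k. if i = j then r i else 0)"
    by (intro sum.cong) auto
  then show "r j = (\<Sum>i=1..k. int (of_bool (i = j)) * r i)" using assms by simp
  have "(\<Sum>i=1..k. of_bool (i = j)) = (\<Sum>i=1..k. if i = j then 1 else (0::nat))"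
    by (intro sum.cong) auto
  then show "1 = (\<Sum>i=1..k. of_bool (i = j) :: nat)" using assms by simp
qed

lemma has_length_mult:
  assumes "has_length x c"
  shows "has_length (int q * x) (q * c)"
proof (induction q)
  case (Suc q)
  then show ?case using has_length_add[OF Suc assms] by (simp add: algebra_simps)
qed (simp add: has_length_0)

text \<open>
  Lists of indices instead of multiplicities make it possible to cut out a block of terms.
\<close>
lemma has_length_iff_list:
  "has_length x c \<longleftrightarrow> (\<exists>xs. set xs \<subseteq> {1..k} \<and> length xs = c \<and> sum_list (map r xs) = x)"
proof
  assume "has_length x c"
  then obtain l where l: "x = (\<Sum>j=1..k. int (l j) * r j)" "c = (\<Sum>j=1..k. l j)"
    unfolding has_length_def by blast
  define xs where "xs = concat (map (\<lambda>j. replicate (l j) j) [1..<Suc k])"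
  have "length xs = c"
    unfolding xs_def l(2) length_concat map_map o_def
    by (simp add: interv_sum_list_conv_sum_set_nat atLeastLessThanSuc_atLeastAtMost del: upt_Suc)
  moreover have "sum_list (map r (concat (map (\<lambda>j. replicate (l j) j) js)))
      = (\<Sum>j\<leftarrow>js. int (l j) * r j)" for js
    by (induction js) (simp_all add: sum_list_replicate)
  then have "sum_list (map r xs) = x"
    unfolding xs_def l(1)
    by (simp add: interv_sum_list_conv_sum_set_nat atLeastLessThanSuc_atLeastAtMost del: upt_Suc)
  moreover have "set xs \<subseteq> {1..k}"
    by (auto simp: xs_def simp del: upt_Suc)
  ultimately show "\<exists>xs. set xs \<subseteq> {1..k} \<and> length xs = c \<and> sum_list (map r xs) = x" by blast
next
  have "has_length (sum_list (map r xs)) (length xs)" if "set xs \<subseteq> {1..k}" for xs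
    using that
  proof (induction xs)
    case (Cons j xs)
    then show ?case
      using has_length_add[OF has_length_gen[of j], of "sum_list (map r xs)" "length xs"] by simp
  qed (simp add: has_length_0)
  then show "\<exists>xs. set xs \<subseteq> {1..k} \<and> length xs = c \<and> sum_list (map r xs) = x \<Longrightarrow> has_length x c"
    by blast
qed

lemma S_iff: "x \<in> S \<longleftrightarrow> (\<exists>c. has_length x c)"
  unfolding S_semi_def gen_semigroup_def has_length_def by auto

lemma S_add: "x \<in> S \<Longrightarrow> y \<in> S \<Longrightarrow> x + y \<in> S"
  unfolding S_iff using has_length_add by blast

lemma S_mult: "x \<in> S \<Longrightarrow> 0 \<le> q \<Longrightarrow> q * x \<in> S"
  unfolding S_iff using has_length_mult by (metis int_nat_eq)

lemma S_gen: "j \<in> {1..k} \<Longrightarrow> r j \<in> S"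
  unfolding S_iff using has_length_gen by blast

lemma has_length_bounds:
  assumes "has_length x c"
  shows "0 \<le> x" "x \<le> int c * R"
proof -
  obtain l where l: "x = (\<Sum>j=1..k. int (l j) * r j)" "c = (\<Sum>j=1..k. l j)"
    using assms unfolding has_length_def by blast
  show "0 \<le> x"
    unfolding l(1) using r_pos by (intro sum_nonneg) (simp add: order_less_imp_le)
  show "x \<le> int c * R"
    unfolding l of_nat_sum sum_distrib_right using r_le
    by (intro sum_mono mult_left_mono) auto
qed

lemma S_nonneg: "x \<in> S \<Longrightarrow> 0 \<le> x"
  unfolding S_iff using has_length_bounds by blast

lemma S_dvd: "x \<in> S \<Longrightarrow> d dvd x"
  unfolding S_iff has_length_def using d_dvd_r by (force intro!: dvd_sum)

lemma has_length_len: "x \<in> S \<Longrightarrow> has_length x (len x)"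
  unfolding S_iff min_len_def has_length_def[symmetric] by (metis LeastI)

lemma len_le: "has_length x c \<Longrightarrow> len x \<le> c"
  unfolding min_len_def has_length_def[symmetric] by (rule Least_le)

text \<open>
  If at least \<open>R\<close> terms of an expression differ from \<open>R\<close>, some nonempty block of them sums to
  \<open>t R\<close>. Every term of the block is less than \<open>R\<close>, so \<open>t\<close> is less than the length of the block,
  and \<open>t\<close> copies of \<open>R\<close> give a shorter expression.
\<close>
lemma minimal_expression:
  assumes "x \<in> S"
  obtains y c q where "has_length y c" "int c < R" "x = y + int q * R" "len x = c + q"
proof -
  obtain xs where xs: "set xs \<subseteq> {1..k}" "length xs = len x" "sum_list (map r xs) = x"
    using has_length_len[OF assms] unfolding has_length_iff_list by blast
  define ys where "ys = filter (\<lambda>j. j \<noteq> k) xs"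
  define q where "q = length (filter (\<lambda>j. j = k) xs)"
  have len: "length xs = length ys + q"
    unfolding ys_def q_def by (induction xs) auto
  have sum: "sum_list (map r xs) = sum_list (map r ys) + int q * R"
    unfolding ys_def q_def by (induction xs) (auto simp: algebra_simps)
  have ys: "set ys \<subseteq> {1..k} - {k}"
    using xs(1) by (auto simp: ys_def)
  have small: "int (length ys) < R"
  proof (rule ccontr)
    assume "\<not> int (length ys) < R"
    then obtain A B C where ABC: "ys = A @ B @ C" "B \<noteq> []" "R dvd sum_list (map r B)"
      using zero_sum_block[of R ys r] R_pos by auto
    obtain t where t: "sum_list (map r B) = R * t"
      using ABC(3) by blast
    have B: "set B \<subseteq> {1..k} - {k}"
      using ys ABC(1) by auto
    have "0 \<le> sum_list (map r B)"
      using B r_pos by (intro sum_list_nonneg) (force intro: order_less_imp_le)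
    then have "0 \<le> t" using t R_pos by (simp add: zero_le_mult_iff)
    have "sum_list (map r B) < int (length B) * R"
      using ABC(2) B
    proof (induction B)
      case (Cons j B)
      then show ?case
        using r_less[of j] by (cases "B = []") (auto simp: algebra_simps)
    qed simp
    then have "t < int (length B)"
      using t R_pos by (simp add: mult.commute)
    define zs where "zs = A @ C @ replicate (nat t + q) k"
    have "set zs \<subseteq> {1..k}"
      using ys k_pos by (auto simp: zs_def ABC(1))
    moreover have "sum_list (map r zs) = x"
      using t \<open>0 \<le> t\<close> unfolding xs(3)[symmetric] sum
      by (simp add: zs_def ABC(1) sum_list_replicate algebra_simps)
    ultimately have "has_length x (length zs)"
      unfolding has_length_iff_list by blast
    moreover have "length zs < len x"
      using \<open>t < int (length B)\<close> \<open>0 \<le> t\<close> unfolding xs(2)[symmetric] len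
      by (simp add: zs_def ABC(1))
    ultimately show False using len_le by fastforce
  qed
  have "has_length (sum_list (map r ys)) (length ys)"
    unfolding has_length_iff_list using ys by blast
  then show thesis
    using that[of "sum_list (map r ys)" "length ys" q] small len sum xs by simp
qed

text \<open>
  Fewer than \<open>R\<close> terms other than \<open>R\<close> cannot sum to \<open>R\<^sup>2\<close> or more, so a shortest expression of
  \<open>x + R\<close> contains \<open>R\<close>, and dropping it gives an expression of \<open>x\<close>.
\<close>
lemma len_add_R:
  assumes "x \<in> S" "R\<^sup>2 \<le> x + R"
  shows "len (x + R) = len x + 1"
proof (rule antisym)
  show "len (x + R) \<le> len x + 1"
    using has_length_add[OF has_length_len[OF assms(1)] has_length_gen[of k]] k_pos
    by (intro len_le) simp
  have "x + R \<in> S" using assms(1) S_add S_gen[of k] k_pos by simp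
  then obtain y c q where y: "has_length y c" "int c < R" "x + R = y + int q * R" "len (x + R) = c + q"
    by (rule minimal_expression)
  have "q \<noteq> 0"
  proof
    assume "q = 0"
    then have "x + R \<le> int c * R" using has_length_bounds(2)[OF y(1)] y(3) by simp
    also have "\<dots> < R\<^sup>2" using y(2) R_pos by (simp add: power2_eq_square)
    finally show False using assms(2) by simp
  qed
  then obtain p where p: "q = Suc p" by (cases q) auto
  have "has_length (y + int p * R) (c + p * 1)"
    using y(1) k_pos by (intro has_length_add has_length_mult has_length_gen) auto
  moreover have "x = y + int p * R" using y(3) p by (simp add: algebra_simps)
  ultimately show "len x + 1 \<le> len (x + R)"
    using len_le[of x "c + p"] y(4) p by simp
qed

lemma len_add_mult_R:
  assumes "x \<in> S" "R\<^sup>2 \<le> x + R"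
  shows "len (x + int q * R) = len x + q"
proof (induction q)
  case (Suc q)
  have "x + int q * R \<in> S"
    using assms(1) k_pos by (intro S_add S_mult S_gen) auto
  moreover have "R\<^sup>2 \<le> (x + int q * R) + R"
    using assms(2) mult_nonneg_nonneg[of "int q" R] R_pos by linarith
  ultimately show ?case
    using len_add_R[of "x + int q * R"] Suc by (simp add: algebra_simps)
qed simp

text \<open>
  The length of any element \<open>z\<close> of \<open>S\<close> lies between \<open>z / R\<close> and \<open>z / R + R - 1\<close>, with the upper
  bound from the form of a shortest expression.
\<close>
lemma len_less:
  assumes "x \<in> S" "y \<in> S" "x + R\<^sup>2 \<le> y"
  shows "len x < len y"
proof -
  obtain z c q where z: "has_length z c" "int c < R" "x = z + int q * R" "len x = c + q"
    using assms(1) by (rule minimal_expression)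
  have "int (len x) * R \<le> int c * R + x"
    using has_length_bounds(1)[OF z(1)] z(3,4) by (simp add: algebra_simps)
  also have "\<dots> < R\<^sup>2 + x"
    using z(2) R_pos by (simp add: power2_eq_square)
  also have "\<dots> \<le> y" using assms(3) by simp
  also have "y \<le> int (len y) * R"
    using has_length_bounds(2)[OF has_length_len[OF assms(2)]] .
  finally show ?thesis using R_pos by simp
qed

text \<open>
  Making the Bezout coefficients of \<open>d\<close> nonnegative by adding multiples of \<open>R\<close> yields an element
  \<open>e\<close> of \<open>S\<close> congruent to \<open>d\<close> mod \<open>R\<close>. The multiples \<open>v e\<close> with \<open>0 \<le> v < R\<close> then meet every
  class mod \<open>R\<close> of multiples of \<open>d\<close>, and adding copies of \<open>R\<close> reaches everything larger in
  that class.
\<close>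
lemma S_contains_large_multiples: "\<exists>b. \<forall>x. d dvd x \<and> b < x \<longrightarrow> x \<in> S"
proof -
  obtain c where c: "d = (\<Sum>j\<in>{1..k}. c j * r j)"
    using Gcd_image_eq_sum[of "{1..k}" r] unfolding gcd_r_def by auto
  define e where "e = (\<Sum>j=1..k. int (nat (c j + \<bar>c j\<bar> * R)) * r j)"
  have "e \<in> S" unfolding e_def S_semi_def gen_semigroup_def
    by (intro CollectI exI[of _ "\<lambda>j. nat (c j + \<bar>c j\<bar> * R)"]) simp
  have "0 \<le> c j + \<bar>c j\<bar> * R" for j
  proof -
    have "\<bar>c j\<bar> * 1 \<le> \<bar>c j\<bar> * R" using R_pos by (intro mult_left_mono) auto
    then show ?thesis by linarith
  qed
  then have "e = d + R * (\<Sum>j=1..k. \<bar>c j\<bar> * r j)"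
    unfolding e_def c by (simp add: sum.distrib sum_distrib_left algebra_simps)
  then have "R dvd e - d" by simp
  have "x \<in> S" if dvd: "d dvd x" and less: "R * e < x" for x
  proof -
    obtain u where u: "x = d * u" using dvd by blast
    define v where "v = u mod R"
    have v: "0 \<le> v" "v \<le> R" using R_pos by (simp_all add: v_def order_less_imp_le)
    have "R dvd u - v" by (simp add: v_def)
    then have "R dvd d * (u - v) - (e - d) * v"
      using \<open>R dvd e - d\<close> by (meson dvd_diff dvd_mult dvd_mult2)
    then obtain q where q: "x = v * e + q * R"
      unfolding u dvd_def by (auto simp: algebra_simps)
    have "v * e \<le> R * e" using v S_nonneg[OF \<open>e \<in> S\<close>] by (intro mult_right_mono)
    then have "0 < q * R" using q less by linarith
    then have "0 \<le> q" using R_pos by (simp add: zero_less_mult_iff)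
    then show ?thesis
      unfolding q using v \<open>e \<in> S\<close> k_pos by (intro S_add S_mult S_gen) auto
  qed
  then show ?thesis by blast
qed

lemma le_Frob:
  assumes "d dvd x" "x \<notin> S"
  shows "x \<le> Frob k r"
proof -
  obtain b where b: "\<And>x. d dvd x \<Longrightarrow> b < x \<Longrightarrow> x \<in> S"
    using S_contains_large_multiples by blast
  show ?thesis
    unfolding Frob_def
  proof (rule le_Greatest_int[where a = x and b = b])
    show "y \<le> b" if "y \<notin> S \<and> [y = 0] (mod d)" for y
      using that b by (force simp: cong_0_iff)
  qed (use assms in \<open>auto simp: cong_0_iff\<close>)
qed

section \<open>Membership in the shifted semigroup\<close>

text \<open>
  \<open>L\<close> counts all generators of the shifted semigroup, \<open>s\<close> collects their shifts; the difference
  between \<open>L\<close> and the length of \<open>s\<close> is made up by copies of \<open>n = n + r 0\<close>.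
\<close>
lemma M_iff: "x \<in> M n \<longleftrightarrow> (\<exists>L s. s \<in> S \<and> int (len s) \<le> L \<and> x = L * n + s)"
proof
  assume "x \<in> M n"
  then obtain l where l: "x = (\<Sum>j\<in>{0..k}. int (l j) * (n + r j))"
    unfolding M_semi_def gen_semigroup_def by blast
  define s where "s = (\<Sum>j=1..k. int (l j) * r j)"
  have s: "has_length s (\<Sum>j=1..k. l j)"
    unfolding has_length_def s_def by blast
  have "{0..k} = insert 0 {1..k}" by auto
  then have "x = (\<Sum>j=0..k. int (l j)) * n + s"
    unfolding l s_def by (simp add: sum.distrib sum_distrib_left algebra_simps r_0)
  moreover have "int (len s) \<le> (\<Sum>j=0..k. int (l j))"
    using len_le[OF s] \<open>{0..k} = insert 0 {1..k}\<close> by (simp flip: of_nat_sum)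
  moreover have "s \<in> S" using s S_iff by blast
  ultimately show "\<exists>L s. s \<in> S \<and> int (len s) \<le> L \<and> x = L * n + s" by blast
next
  assume "\<exists>L s. s \<in> S \<and> int (len s) \<le> L \<and> x = L * n + s"
  then obtain L s where s: "s \<in> S" "int (len s) \<le> L" "x = L * n + s" by blast
  obtain l where l: "s = (\<Sum>j=1..k. int (l j) * r j)" "len s = (\<Sum>j=1..k. l j)"
    using has_length_len[OF s(1)] unfolding has_length_def by blast
  define l' where "l' = l(0 := nat (L - int (len s)))"
  have "(\<Sum>j=0..k. int (l' j) * (n + r j)) = int (l' 0) * n + (\<Sum>j=1..k. int (l' j) * (n + r j))"
    by (simp add: sum.atLeast_Suc_atMost r_0)
  also have "(\<Sum>j=1..k. int (l' j) * (n + r j)) = (\<Sum>j=1..k. int (l j) * (n + r j))"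
    by (intro sum.cong) (auto simp: l'_def)
  also have "\<dots> = int (len s) * n + s"
    unfolding l(2) of_nat_sum
    by (subst l(1)) (simp add: sum.distrib sum_distrib_left algebra_simps)
  finally have "x = (\<Sum>j=0..k. int (l' j) * (n + r j))"
    using s(2,3) by (simp add: l'_def algebra_simps)
  then show "x \<in> M n" unfolding M_semi_def gen_semigroup_def by blast
qed

lemma M_add:
  assumes "x \<in> M n" "y \<in> M n"
  shows "x + y \<in> M n"
proof -
  obtain L s L' s' where *: "s \<in> S" "int (len s) \<le> L" "x = L * n + s"
    "s' \<in> S" "int (len s') \<le> L'" "y = L' * n + s'"
    using assms unfolding M_iff by blast
  have "len (s + s') \<le> len s + len s'"
    using * by (intro len_le has_length_add has_length_len)
  then have "int (len (s + s')) \<le> L + L'" using * by linarith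
  moreover have "x + y = (L + L') * n + (s + s')" using * by (simp add: algebra_simps)
  ultimately show ?thesis unfolding M_iff using * S_add by blast
qed

lemma M_gen: "j \<in> {0..k} \<Longrightarrow> n + r j \<in> M n"
  unfolding M_semi_def gen_semigroup_def
  by (intro CollectI exI[of _ "\<lambda>i. if i = j then 1 else 0"])
    (simp add: if_distrib[of int] if_distrib[of "\<lambda>x. x * _"] cong: if_cong)

text \<open>
  A nonzero element of the semigroup is a generator plus another element, so it suffices to test
  generators.
\<close>
lemma PF_M_iff:
  assumes "0 < n"
  shows "g \<in> PF (M n) \<longleftrightarrow> g \<notin> M n \<and> (\<forall>j\<in>{0..k}. g + (n + r j) \<in> M n)"
proof -
  have "n + r j \<noteq> 0" if "j \<in> {0..k}" for j
    using that assms r_pos[of j] r_0 by (cases "j = 0") auto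
  moreover have "g + h \<in> M n" if gen: "\<forall>j\<in>{0..k}. g + (n + r j) \<in> M n"
    and h: "h \<in> M n" "h \<noteq> 0" for h
  proof -
    obtain l where l: "h = (\<Sum>j\<in>{0..k}. int (l j) * (n + r j))"
      using h(1) unfolding M_semi_def gen_semigroup_def by blast
    with h(2) obtain i where i: "i \<in> {0..k}" "l i \<noteq> 0"
      by (metis (no_types, lifting) mult_zero_left of_nat_0 sum.neutral)
    define l' where "l' = l(i := l i - 1)"
    have "h = (n + r i) + (\<Sum>j\<in>{0..k}. int (l' j) * (n + r j))"
    proof -
      have "h = int (l i) * (n + r i) + (\<Sum>j\<in>{0..k} - {i}. int (l j) * (n + r j))"
        unfolding l using i(1) by (simp add: sum.remove)
      also have "(\<Sum>j\<in>{0..k} - {i}. int (l j) * (n + r j)) = (\<Sum>j\<in>{0..k} - {i}. int (l' j) * (n + r j))"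
        by (intro sum.cong) (auto simp: l'_def)
      also have "int (l i) * (n + r i) = (n + r i) + int (l' i) * (n + r i)"
        using i(2) by (simp add: l'_def of_nat_diff algebra_simps)
      finally show ?thesis
        using i(1) by (simp add: sum.remove[of _ i "\<lambda>j. int (l' j) * (n + r j)"])
    qed
    then have "g + h = (g + (n + r i)) + (\<Sum>j\<in>{0..k}. int (l' j) * (n + r j))"
      by simp
    moreover have "(\<Sum>j\<in>{0..k}. int (l' j) * (n + r j)) \<in> M n"
      unfolding M_semi_def gen_semigroup_def by blast
    moreover have "g + (n + r i) \<in> M n"
      using gen i(1) by blast
    ultimately show ?thesis
      by (simp only: M_add)
  qed
  ultimately show ?thesis
    using M_gen[of _ n] by (auto simp: PF_def)
qed

definition admissible :: "int \<Rightarrow> bool" where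
  "admissible n \<longleftrightarrow> N0 k r < n \<and> coprime n d"

lemma admissible_bounds:
  assumes "admissible n"
  shows "R\<^sup>2 < n" "0 < n" "n \<le> d * n" "Frob k r + R < d * n"
proof -
  have n: "R\<^sup>2 < n" "R\<^sup>2 + Frob k r * R < n"
    using assms by (auto simp: admissible_def N0_def)
  then show "R\<^sup>2 < n" by simp
  show "0 < n" using n(1) by (smt (verit) zero_le_power2)
  then show le: "n \<le> d * n" using d_pos by simp
  have "R * 1 \<le> R * R" using R_pos by (intro mult_left_mono) auto
  then have R: "R \<le> R\<^sup>2" by (simp add: power2_eq_square)
  show "Frob k r + R < d * n"
  proof (cases "0 \<le> Frob k r")
    case True
    then have "Frob k r * 1 \<le> Frob k r * R" using R_pos by (intro mult_left_mono) auto
    then show ?thesis using n R le by linarith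
  qed (use n R le in linarith)
qed

lemma admissible_add_R:
  assumes "admissible n"
  shows "admissible (n + R)"
proof -
  obtain q where "R = d * q" using d_dvd_R by blast
  then have "coprime (n + R) d \<longleftrightarrow> coprime n d"
    by (metis coprime_iff_gcd_eq_1 gcd.commute gcd_add_mult mult.commute add.commute)
  then show ?thesis using assms R_pos by (simp add: admissible_def)
qed

lemma multiple_in_S:
  assumes "admissible n" "0 \<le> t"
  shows "t * (d * n) \<in> S"
proof -
  have "d * n \<in> S" using le_Frob[of "d * n"] admissible_bounds(4)[OF assms(1)] R_pos by fastforce
  then show ?thesis using assms(2) S_mult by blast
qed

text \<open>
  Multiples of \<open>d\<close> that agree mod \<open>n\<close> agree mod \<open>d n\<close>; this is where coprimality enters.
\<close>
lemma cong_n_dest: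
  assumes "admissible n" "d dvd x" "d dvd y" "[x = y] (mod n)"
  obtains t where "y = x + t * (d * n)"
proof -
  have "n dvd y - x" using assms(4) by (metis cong_iff_dvd_diff dvd_diff_commute)
  moreover have "d dvd y - x" using assms by simp
  ultimately have "d * n dvd y - x"
    using assms(1) by (intro divides_mult) (auto simp: admissible_def coprime_commute)
  then obtain t where "y - x = d * n * t" by blast
  then show thesis using that[of t] by (simp add: algebra_simps)
qed

text \<open>
  Since \<open>d n\<close> exceeds the Frobenius number, it lies in \<open>S\<close>, so an element of \<open>S\<close> below \<open>i\<close> in the
  class of \<open>i\<close> mod \<open>d n\<close> would put \<open>i - d n\<close> into \<open>S\<close>.
\<close>
lemma Ap_minimal:
  assumes "admissible n" "i \<in> Ap S (d * n)" "s \<in> S" "s = i + t * (d * n)"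
  shows "0 \<le> t"
proof (rule ccontr)
  assume "\<not> 0 \<le> t"
  then have "s + (- t - 1) * (d * n) \<in> S"
    using assms multiple_in_S S_add by simp
  then have "i - d * n \<in> S" using assms(4) by (simp add: algebra_simps)
  then show False using assms(2) by (simp add: Ap_def)
qed

lemma Ap_cong_unique:
  assumes "admissible n" "i \<in> Ap S (d * n)" "j \<in> Ap S (d * n)" "[i = j] (mod n)"
  shows "i = j"
proof -
  have "i \<in> S" "j \<in> S" using assms by (auto simp: Ap_def)
  obtain t where t: "j = i + t * (d * n)"
    using cong_n_dest[OF assms(1) S_dvd S_dvd assms(4)] \<open>i \<in> S\<close> \<open>j \<in> S\<close> by blast
  moreover have "0 \<le> t" using Ap_minimal[OF assms(1,2) \<open>j \<in> S\<close> t] .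
  moreover have "0 \<le> - t" using t by (intro Ap_minimal[OF assms(1,3) \<open>i \<in> S\<close>]) simp
  ultimately show ?thesis by simp
qed

lemma len_mono_shift:
  assumes "admissible n" "x \<in> S" "y \<in> S" "y = x + t * (d * n)" "0 \<le> t"
  shows "len x \<le> len y"
proof (cases "t = 0")
  case False
  have "R\<^sup>2 \<le> 1 * (d * n)" using admissible_bounds(1,3)[OF assms(1)] by linarith
  also have "\<dots> \<le> t * (d * n)"
    using False assms(5) admissible_bounds[OF assms(1)] by (intro mult_right_mono) auto
  finally show ?thesis using len_less[OF assms(2,3)] assms(4) by simp
qed (use assms in simp)

text \<open>
  Comparing two descriptions of one element of \<open>M n\<close>: raising \<open>s\<close> by \<open>t d n\<close> costs \<open>t d\<close> of the
  available length. The cost pairs with \<open>len_mono_shift\<close>, so that nothing is gained by a larger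
  \<open>s\<close>.
\<close>
lemma M_representative:
  assumes "admissible n" "x \<in> S" "b * n + x \<in> M n"
  obtains L s t where "s \<in> S" "int (len s) \<le> L" "s = x + t * (d * n)" "L = b - t * d"
proof -
  obtain L s where s: "s \<in> S" "int (len s) \<le> L" "b * n + x = L * n + s"
    using assms(3) unfolding M_iff by blast
  have "s - x = (b - L) * n" using s(3) by (simp add: algebra_simps)
  then have "[x = s] (mod n)"
    by (metis cong_iff_dvd_diff cong_sym dvd_triv_right)
  then obtain t where t: "s = x + t * (d * n)"
    using cong_n_dest[OF assms(1) S_dvd S_dvd] assms(2) s(1) by blast
  then have "(L - (b - t * d)) * n = 0" using s(3) by (simp add: algebra_simps)
  then have "L = b - t * d" using admissible_bounds(2)[OF assms(1)] by simp
  then show thesis using that s t by blast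
qed

lemma Ap_len_least:
  assumes "admissible n" "i \<in> Ap S (d * n)"
  shows "b * n + i \<in> M n \<longleftrightarrow> int (len i) \<le> b"
proof
  have i: "i \<in> S" using assms(2) by (simp add: Ap_def)
  assume "b * n + i \<in> M n"
  then obtain L s t where s: "s \<in> S" "int (len s) \<le> L" "s = i + t * (d * n)" "L = b - t * d"
    using M_representative[OF assms(1) i] by blast
  have t: "0 \<le> t" using Ap_minimal[OF assms s(1,3)] .
  have "len i \<le> len s" using len_mono_shift[OF assms(1) i s(1,3) t] .
  moreover have "0 \<le> t * d" using t d_pos by simp
  ultimately show "int (len i) \<le> b" using s(2,4) by linarith
next
  assume "int (len i) \<le> b"
  then show "b * n + i \<in> M n"
    using assms(2) unfolding M_iff Ap_def by blast
qed

section \<open>Pseudo-Frobenius numbers of the shifted semigroup\<close>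

text \<open>
  For admissible \<open>n\<close> and an Apery element \<open>i\<close> this is the largest integer in the class of \<open>i\<close> mod \<open>n\<close> outside
  \<open>M n\<close>, hence the only candidate for a pseudo-Frobenius number in that class.
\<close>
definition PF_of :: "int \<Rightarrow> int \<Rightarrow> int" where
  "PF_of n i = i + (int (len i) - 1) * n"

lemma PF_of_cong: "[PF_of n i = i] (mod n)"
  by (simp add: PF_of_def cong_iff_dvd_diff)

lemma PF_eq_PF_of:
  assumes "admissible n" "i \<in> Ap S (d * n)" "f \<in> PF (M n)" "[f = i] (mod n)"
  shows "f = PF_of n i"
proof -
  have "n dvd f - i" using assms(4) by (simp add: cong_iff_dvd_diff)
  then obtain b where b: "f - i = n * b" by blast
  then have f: "f = b * n + i" by (simp add: algebra_simps)
  have "f \<notin> M n" "f + (n + r 0) \<in> M n"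
    using assms(3) PF_M_iff[OF admissible_bounds(2)[OF assms(1)]] by auto
  moreover have "f + (n + r 0) = (b + 1) * n + i" by (simp add: f r_0 algebra_simps)
  ultimately have "\<not> int (len i) \<le> b" "int (len i) \<le> b + 1"
    using Ap_len_least[OF assms(1,2)] f by metis+
  then have "b = int (len i) - 1" by linarith
  then show ?thesis by (simp add: f PF_of_def)
qed

text \<open>
  The element is described by \<open>s = i + r j + t d n\<close> for some \<open>t\<close>. For \<open>t \<ge> 0\<close> one may as well take
  \<open>t = 0\<close>; \<open>t = -1\<close> is the second alternative; \<open>t \<le> -2\<close> is impossible, because
  \<open>i - d n \<notin> S\<close> bounds \<open>i\<close> by \<open>d n\<close> plus the Frobenius number, and so \<open>i + r j < 2 d n\<close>.
\<close>
lemma generator_shift_iff: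
  assumes "admissible n" "i \<in> Ap S (d * n)" "j \<in> {1..k}"
  shows "int (len i) * n + (i + r j) \<in> M n \<longleftrightarrow>
    len (i + r j) \<le> len i \<or>
    i + r j - d * n \<in> S \<and> int (len (i + r j - d * n)) \<le> int (len i) + d"
proof
  have i: "i \<in> S" "i - d * n \<notin> S" using assms(2) by (auto simp: Ap_def)
  have ij: "i + r j \<in> S" using i assms(3) S_add S_gen by simp
  assume "int (len i) * n + (i + r j) \<in> M n"
  then obtain L s t where s: "s \<in> S" "int (len s) \<le> L" "s = i + r j + t * (d * n)"
    "L = int (len i) - t * d"
    using M_representative[OF assms(1) ij] by blast
  have "i - d * n \<le> Frob k r"
    using le_Frob[OF _ i(2)] S_dvd[OF i(1)] by simp
  then have "i + r j < 2 * (d * n)"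
    using admissible_bounds(4)[OF assms(1)] r_le[OF assms(3)] by simp
  moreover have "0 \<le> s" using S_nonneg s(1) .
  ultimately have "0 < (t + 2) * (d * n)" using s(3) by (simp add: algebra_simps)
  then have "- 1 \<le> t"
    using admissible_bounds[OF assms(1)] by (simp add: zero_less_mult_iff)
  show "len (i + r j) \<le> len i \<or>
    i + r j - d * n \<in> S \<and> int (len (i + r j - d * n)) \<le> int (len i) + d"
  proof (cases "t = - 1")
    case True
    then show ?thesis using s by simp
  next
    case False
    then have t: "0 \<le> t" using \<open>- 1 \<le> t\<close> by simp
    then have "len (i + r j) \<le> len s" using len_mono_shift[OF assms(1) ij s(1,3)] by simp
    moreover have "0 \<le> t * d" using t d_pos by simp
    ultimately show ?thesis using s(2,4) by linarith
  qed
next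
  have ij: "i + r j \<in> S" using assms(2,3) S_add S_gen by (simp add: Ap_def)
  assume "len (i + r j) \<le> len i \<or>
    i + r j - d * n \<in> S \<and> int (len (i + r j - d * n)) \<le> int (len i) + d"
  then show "int (len i) * n + (i + r j) \<in> M n"
  proof
    assume "len (i + r j) \<le> len i"
    then show ?thesis
      unfolding M_iff using ij by (intro exI[of _ "int (len i)"] exI[of _ "i + r j"]) simp
  next
    assume "i + r j - d * n \<in> S \<and> int (len (i + r j - d * n)) \<le> int (len i) + d"
    moreover have "int (len i) * n + (i + r j) = (int (len i) + d) * n + (i + r j - d * n)"
      by (simp add: algebra_simps)
    ultimately show ?thesis unfolding M_iff by blast
  qed
qed

lemma PF_of_in_PF_iff:
  assumes "admissible n" "i \<in> Ap S (d * n)"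
  shows "PF_of n i \<in> PF (M n) \<longleftrightarrow> (\<forall>j\<in>{1..k}.
    len (i + r j) \<le> len i \<or>
    i + r j - d * n \<in> S \<and> int (len (i + r j - d * n)) \<le> int (len i) + d)"
proof -
  have shift: "PF_of n i + (n + r j) = int (len i) * n + (i + r j)" for j
    by (simp add: PF_of_def algebra_simps)
  have out: "PF_of n i \<notin> M n"
    using Ap_len_least[OF assms, of "int (len i) - 1"] by (simp add: PF_of_def add.commute)
  have zero: "int (len i) * n + (i + r 0) \<in> M n"
    using Ap_len_least[OF assms] by (simp add: r_0)
  have "PF_of n i \<in> PF (M n) \<longleftrightarrow> (\<forall>j\<in>{0..k}. int (len i) * n + (i + r j) \<in> M n)"
    unfolding PF_M_iff[OF admissible_bounds(2)[OF assms(1)]] shift using out by simp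
  also have "\<dots> \<longleftrightarrow> (\<forall>j\<in>insert 0 {1..k}. int (len i) * n + (i + r j) \<in> M n)"
    by (intro ball_cong) auto
  also have "\<dots> \<longleftrightarrow> (\<forall>j\<in>{1..k}. int (len i) * n + (i + r j) \<in> M n)"
    using zero by blast
  also have "\<dots> \<longleftrightarrow> (\<forall>j\<in>{1..k}.
    len (i + r j) \<le> len i \<or>
    i + r j - d * n \<in> S \<and> int (len (i + r j - d * n)) \<le> int (len i) + d)"
    using generator_shift_iff[OF assms] by (intro ball_cong) auto
  finally show ?thesis .
qed

section \<open>Passing from \<open>n\<close> to \<open>n + R\<close>\<close>

lemma psi_in_Ap:
  assumes "i \<in> Ap S (d * n)"
  shows "psi k r n i \<in> Ap S (d * (n + R))"
proof (cases "i < d * n - R")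
  case True
  have "0 < d * R" using d_pos R_pos by simp
  with True have "i - d * (n + R) < 0" using R_pos by (simp add: algebra_simps)
  then have "i - d * (n + R) \<notin> S" using S_nonneg by fastforce
  then show ?thesis using True assms by (simp add: psi_def Ap_def)
next
  case False
  have "d * R \<in> S" using S_mult[OF S_gen[of k], of d] d_pos k_pos by simp
  then show ?thesis using False assms S_add by (simp add: psi_def Ap_def algebra_simps)
qed

lemma len_add_d_R:
  assumes "admissible n" "x \<in> S" "d * n - R \<le> x"
  shows "int (len (x + d * R)) = int (len x) + d"
proof -
  have "R\<^sup>2 \<le> x + R" using admissible_bounds(1,3)[OF assms(1)] assms(3) by linarith
  from len_add_mult_R[OF assms(2) this, of "nat d"] show ?thesis using d_pos by simp
qed

text \<open>
  For small \<open>i\<close> the criterion reduces to its first alternative, which is independent of \<open>n\<close>. For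
  large \<open>i\<close> both sides of the first alternative grow by \<open>d\<close>, whereas in the second only the right
  side does.
\<close>
lemma PF_of_psi_in_PF:
  assumes "admissible n" "i \<in> Ap S (d * n)" "PF_of n i \<in> PF (M n)"
  shows "PF_of (n + R) (psi k r n i) \<in> PF (M (n + R))"
proof -
  let ?i = "psi k r n i"
  have i: "i \<in> S" using assms(2) by (simp add: Ap_def)
  have "len (?i + r j) \<le> len ?i \<or>
      ?i + r j - d * (n + R) \<in> S \<and> int (len (?i + r j - d * (n + R))) \<le> int (len ?i) + d"
    if j: "j \<in> {1..k}" for j
  proof -
    have ij: "i + r j \<in> S" using i j S_add S_gen by simp
    have *: "len (i + r j) \<le> len i \<or>
      i + r j - d * n \<in> S \<and> int (len (i + r j - d * n)) \<le> int (len i) + d"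
      using assms(3) j unfolding PF_of_in_PF_iff[OF assms(1,2)] by blast
    show ?thesis
    proof (cases "i < d * n - R")
      case True
      then have "i + r j - d * n < 0" using r_le[OF j] by simp
      then have "i + r j - d * n \<notin> S" using S_nonneg by fastforce
      then show ?thesis using * True by (simp add: psi_def)
    next
      case False
      then have len: "int (len (i + d * R)) = int (len i) + d"
          "int (len (i + r j + d * R)) = int (len (i + r j)) + d"
        using len_add_d_R[OF assms(1) i] len_add_d_R[OF assms(1) ij] r_pos[OF j] by simp_all
      have psi: "?i = i + d * R" using False by (simp add: psi_def)
      have shift: "i + d * R + r j = i + r j + d * R"
          "i + r j + d * R - d * (n + R) = i + r j - d * n"
        by (simp_all add: algebra_simps)
      from * show ?thesis
        unfolding psi shift using len d_pos by linarith
    qed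
  qed
  then show ?thesis
    using PF_of_in_PF_iff[OF admissible_add_R[OF assms(1)] psi_in_Ap[OF assms(2)]] by blast
qed

lemma phi_PF_of:
  assumes "admissible n" "i \<in> Ap S (d * n)" "PF_of n i \<in> PF (M n)"
  shows "phi k r n (PF_of n i) = PF_of (n + R) (psi k r n i)"
proof -
  have the_i: "(THE i'. i' \<in> P_set k r n \<and> [PF_of n i = i'] (mod n)) = i"
  proof (rule the_equality)
    show "i \<in> P_set k r n \<and> [PF_of n i = i] (mod n)"
      using assms PF_of_cong by (auto simp: P_set_def)
    show "i' = i" if "i' \<in> P_set k r n \<and> [PF_of n i = i'] (mod n)" for i'
      using that Ap_cong_unique[OF assms(1,2), of i'] PF_of_cong[of n i]
      unfolding P_set_def by (metis (mono_tags, lifting) cong_sym cong_trans mem_Collect_eq)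
  qed
  have adm: "admissible (n + R)" using admissible_add_R assms(1) .
  have "(THE g. g \<in> PF (M (n + R)) \<and> [g = psi k r n i] (mod (n + R))) = PF_of (n + R) (psi k r n i)"
    using PF_of_psi_in_PF[OF assms] PF_of_cong PF_eq_PF_of[OF adm psi_in_Ap[OF assms(2)]]
    by (intro the_equality) blast+
  then show ?thesis unfolding phi_def the_i Let_def .
qed

lemma phi_iter_PF_of:
  fixes l :: nat
  assumes "admissible n" "i \<in> Ap S (d * n)" "PF_of n i \<in> PF (M n)"
  defines "I \<equiv> \<lambda>l. if i < d * n - R then i else i + int l * (d * R)"
  shows "phi_iter k r n l (PF_of n i) = PF_of (n + int l * R) (I l)"
proof -
  \<comment> \<open>Both cases of \<open>psi\<close> persist: below the threshold it only moves away from \<open>i\<close>, otherwise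
    \<open>i\<close> and the threshold both move by \<open>d R\<close>.\<close>
  have psi: "psi k r (n + int l * R) (I l) = I (Suc l)" for l
  proof (cases "i < d * n - R")
    case True
    have "0 \<le> d * (int l * R)" using d_pos R_pos by simp
    with True have "i < d * (n + int l * R) - R" by (simp add: distrib_left)
    then show ?thesis using True by (simp add: psi_def I_def)
  qed (simp add: psi_def I_def algebra_simps)
  have "admissible (n + int l * R) \<and> I l \<in> Ap S (d * (n + int l * R)) \<and>
    PF_of (n + int l * R) (I l) \<in> PF (M (n + int l * R)) \<and>
    phi_iter k r n l (PF_of n i) = PF_of (n + int l * R) (I l)"
  proof (induction l)
    case 0
    then show ?case using assms(1-3) by (simp add: I_def)
  next
    case (Suc l)
    have step: "n + int (Suc l) * R = (n + int l * R) + R" by (simp add: algebra_simps)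
    from Suc have IH: "admissible (n + int l * R)" "I l \<in> Ap S (d * (n + int l * R))"
        "PF_of (n + int l * R) (I l) \<in> PF (M (n + int l * R))"
        "phi_iter k r n l (PF_of n i) = PF_of (n + int l * R) (I l)"
      by blast+
    have "phi_iter k r n (Suc l) (PF_of n i) = PF_of (n + int (Suc l) * R) (I (Suc l))"
      unfolding phi_iter.simps IH(4) phi_PF_of[OF IH(1-3)] psi step ..
    then show ?case
      using admissible_add_R[OF IH(1)] psi_in_Ap[OF IH(2)] PF_of_psi_in_PF[OF IH(1-3)]
      unfolding psi step by blast
  qed
  then show ?thesis by blast
qed

end

theorem corollary2p8:
  fixes k :: nat and r :: "nat \<Rightarrow> int" and n f i :: int and l :: nat
  assumes "2 \<le> k"
    and "r 0 = 0"
    and "strict_mono_on {0..k} r"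
    and "n > N0 k r"
    and "gcd n (gcd_r k r) = 1"
    and "f \<in> PF (M_semi k r n)"
    and "i \<in> Ap (S_semi k r) (gcd_r k r * n)"
    and "[f = i] (mod n)"
  shows "phi_iter k r n l f =
    (if i < gcd_r k r * n - r k
     then f + (int (min_len k r i) - 1) * int l * r k
     else f + (int (min_len k r i) + (int l + 1) * gcd_r k r - 1) * int l * r k
            + int l * gcd_r k r * n)"
proof -
  interpret shifted_family k r
    using assms by unfold_locales auto
  have n: "admissible n"
    using assms(4,5) by (simp add: admissible_def coprime_iff_gcd_eq_1)
  have f: "f = PF_of n i"
    using PF_eq_PF_of n assms(6-8) by blast
  have iter: "phi_iter k r n l f = PF_of (n + int l * R)
      (if i < d * n - R then i else i + int l * (d * R))"
    using phi_iter_PF_of[OF n assms(7)] assms(6) unfolding f by blast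
  show ?thesis
  proof (cases "i < d * n - R")
    case True
    then show ?thesis unfolding iter unfolding f by (simp add: PF_of_def algebra_simps)
  next
    case False
    have "R\<^sup>2 \<le> i + R" using admissible_bounds(1,3)[OF n] False by linarith
    moreover have "i \<in> S" using assms(7) by (simp add: Ap_def)
    ultimately have "len (i + int (l * nat d) * R) = len i + l * nat d"
      by (intro len_add_mult_R)
    then have "int (len (i + int l * (d * R))) = int (len i) + int l * d"
      using d_pos by (simp add: mult.assoc)
    then show ?thesis using False unfolding iter unfolding f by (simp add: PF_of_def algebra_simps)
  qed
qed

end
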